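(* For an integer $d\geq 3$ let $$H:=\left\lceil\frac{1}{(d-2)!}\,c(d+1,2)\right\rceil+1,$$ where $c(n,k)$ denotes the unsigned Stirling number of the first kind. Then for all integers $h\geq H$ the empty lattice $d$-simplex $\mathrm{Pyr}^{d-3}(\mathcal{R}_h)$ is neither Ehrhart positive nor Ehrhart unimodal.
   Context: For an integer $h\geq 1$, the Reeve's tetrahedron is $\mathcal{R}_h:=\mathrm{conv}((0,0,0),(1,0,0),(0,1,0),(1,1,h))\subset\mathbb{R}^3$. For a lattice polytope $P\subset\mathbb{R}^n$, the lattice pyramid over $P$ is $\mathrm{Pyr}(P):=\mathrm{conv}\big((P\times\{0\})\cup\{e_{n+1}\}\big)\subset\mathbb{R}^{n+1}$, where $e_{n+1}$ is the last standard basis vector, and $\mathrm{Pyr}^k(P)$ denotes the $k$-fold iterated pyramid over $P$ (with $\mathrm{Pyr}^0(P)=P$). A lattice simplex is empty if it contains no lattice points other than its vertices. The unsigned Stirling number of the first kind $c(n,k)$ is the number of permutations of $n$ elements with exactly $k$ cycles. For a $d$-dimensional lattice polytope $P\subset\mathbb{R}^n$ (the convex hull of finitely many points of $\mathbb{Z}^n$, with $d$-dimensional affine span) and $t\in\mathbb{Z}_{\geq 0}$, let $tP=\{tp : p\in P\}$ and $i(P;t)=|tP\cap\mathbb{Z}^n|$; this is a polynomial in $t$ of degree $d$ (the Ehrhart polynomial). The $h^\ast$-polynomial $h^\ast(P;z)=h_0^\ast+h_1^\ast z+\cdots+h_d^\ast z^d$ is defined by $\sum_{t\geq 0} i(P;t)z^t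 = h^\ast(P;z)/(1-z)^{d+1}$. $P$ is Ehrhart positive if all coefficients (of $t^0,\dots,t^d$) of $i(P;t)$ are positive (strictly greater than $0$). $P$ is Ehrhart unimodal if there is an index $m\in\{0,1,\ldots,d\}$ with $h_0^\ast\leq\cdots\leq h_m^\ast\geq\cdots\geq h_d^\ast$. *)

theory Defs
  imports
    "HOL-Analysis.Analysis"
    "HOL-Analysis.Finite_Function_Topology"
    "HOL-Computational_Algebra.Computational_Algebra"
    "HOL-Combinatorics.Stirling"
begin

text \<open>
  The pyramid construction raises the ambient dimension, so all spaces \<open>\<real>\<^sup>n\<close> are realised inside
  one real vector space, the finitely supported sequences of reals: a point of \<open>\<real>\<^sup>n\<close> is a
  sequence supported on the coordinates \<open>0, \<dots>, n - 1\<close>. The embedding of \<open>\<real>\<^sup>n\<close> into the space of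
  dimension \<open>n + 1\<close> sending \<open>P\<close> to \<open>P \<times> {0}\<close> is then the identity, and \<open>e\<^sub>n\<^sub>+\<^sub>1\<close> is the unit
  sequence at coordinate \<open>n\<close>. Hulls and affine dependence are those of the library.
\<close>

type_synonym point = "nat \<Rightarrow>\<^sub>0 real"

definition int_lattice :: "nat \<Rightarrow> point set" where
  "int_lattice n =
    {x. Poly_Mapping.keys x \<subseteq> {..<n} \<and> (\<forall>i<n. Poly_Mapping.lookup x i \<in> \<int>)}"

definition reeve_tetrahedron :: "int \<Rightarrow> point set" where
  "reeve_tetrahedron h = convex hull
    {0,
     Poly_Mapping.single 0 1,
     Poly_Mapping.single 1 1,
     Poly_Mapping.single 0 1 + Poly_Mapping.single 1 1 + Poly_Mapping.single 2 (of_int h)}"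

text \<open>The argument \<open>n\<close> is the dimension of the ambient space of \<open>P\<close>.\<close>

definition pyr :: "nat \<Rightarrow> point set \<Rightarrow> point set" where
  "pyr n P = convex hull (P \<union> {Poly_Mapping.single n 1})"

fun pyr_iter :: "nat \<Rightarrow> nat \<Rightarrow> point set \<Rightarrow> point set" where
  "pyr_iter 0 n P = P"
| "pyr_iter (Suc k) n P = pyr (n + k) (pyr_iter k n P)"

text \<open>
  \<open>aff_dim\<close> is only available for Euclidean spaces, so the dimension of \<open>P\<close> is taken to be the
  linear dimension of the direction space of its affine span.
\<close>

definition polytope_dim :: "point set \<Rightarrow> nat" where
  "polytope_dim P = dim {x - y |x y. x \<in> affine hull P \<and> y \<in> affine hull P}"

text \<open>
  The set \<open>V\<close> is the vertex set of the \<open>d\<close>-simplex \<open>P\<close>; affine independence and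
  \<open>card V = d + 1 > 0\<close> force it to be a finite set of \<open>d + 1\<close> vertices.
\<close>

definition empty_lattice_simplex :: "nat \<Rightarrow> nat \<Rightarrow> point set \<Rightarrow> bool" where
  "empty_lattice_simplex n d P \<longleftrightarrow>
    (\<exists>V. V \<subseteq> int_lattice n \<and> \<not> affine_dependent V \<and> card V = d + 1 \<and>
         P = convex hull V \<and> P \<inter> int_lattice n \<subseteq> V)"

definition lattice_count :: "nat \<Rightarrow> point set \<Rightarrow> nat \<Rightarrow> nat" where
  "lattice_count n P t = card ((\<lambda>x. real t *\<^sub>R x) ` P \<inter> int_lattice n)"

definition ehrhart_poly :: "nat \<Rightarrow> point set \<Rightarrow> real poly" where
  "ehrhart_poly n P =
    (THE p. \<forall>t. poly p (real t) = real (lattice_count n P t))"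

definition h_star_poly :: "nat \<Rightarrow> point set \<Rightarrow> real poly" where
  "h_star_poly n P =
    (THE p. degree p \<le> polytope_dim P \<and>
       Abs_fps (\<lambda>t. real (lattice_count n P t)) =
         fps_of_poly p / (1 - fps_X) ^ (polytope_dim P + 1))"

definition ehrhart_positive :: "nat \<Rightarrow> point set \<Rightarrow> bool" where
  "ehrhart_positive n P \<longleftrightarrow> (\<forall>j\<le>polytope_dim P. coeff (ehrhart_poly n P) j > 0)"

definition ehrhart_unimodal :: "nat \<Rightarrow> point set \<Rightarrow> bool" where
  "ehrhart_unimodal n P \<longleftrightarrow>
    (\<exists>m\<le>polytope_dim P.
       (\<forall>j<m. coeff (h_star_poly n P) j \<le> coeff (h_star_poly n P) (j + 1)) \<and>
       (\<forall>j. m \<le> j \<and> j < polytope_dim P \<longrightarrow>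
          coeff (h_star_poly n P) (j + 1) \<le> coeff (h_star_poly n P) j))"

end

theory Submission
  imports Defs
begin

text \<open>
  The \<open>h\<^sup>*\<close>-polynomial of a lattice simplex counts, by height, the lattice points of the half-open
  parallelepiped spanned by its vertices placed at height one. For the pyramid over the Reeve
  tetrahedron of parameter \<open>k\<close> this parallelepiped contains, besides the origin, exactly \<open>k - 1\<close>
  lattice points. They are the points \<open>e\<^sub>0 + e\<^sub>1 + r e\<^sub>2\<close> with \<open>0 < r < k\<close>, all at height two, and the
  apexes added by the pyramids do not enter into them. Concretely, every lattice point of the
  \<open>t\<close>-th dilate is, in a unique way, such a point plus a nonnegative integer combination of the
  vertices whose coefficients sum to \<open>t\<close> minus the height
  (\<open>dilated_reeve_pyramid_lattice\<close>). Counting these combinations gives the Ehrhart polynomial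
  \<open>(t + d choose d) + (k - 1) (t + d - 2 choose d)\<close>.

  All assertions follow from this formula.
  \<^item> At \<open>t = 1\<close> the count is \<open>d + 1\<close>, so the vertices are the only lattice points.
  \<^item> The generating function of the counts gives \<open>h\<^sup>* = 1 + (k - 1) z\<^sup>2\<close>. Its coefficients
    \<open>1, 0, k - 1\<close> fall and then rise as soon as \<open>k > 1\<close>, so they are not unimodal.
  \<^item> The first binomial coefficient is \<open>(t + 1) \<cdots> (t + d) / d!\<close>, with linear coefficient
    \<open>c(d + 1, 2) / d!\<close>. The second is \<open>(t - 1) t (t + 1) \<cdots> (t + d - 2) / d!\<close>, with linear
    coefficient \<open>- (d - 2)! / d!\<close>. The linear coefficient of the Ehrhart polynomial is therefore
    \<open>(c(d + 1, 2) - (k - 1) (d - 2)!) / d!\<close>, and the bound on \<open>k\<close> says precisely that the numerator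
    has become nonpositive.
\<close>

section \<open>Barycentric coordinates on the pyramid\<close>

text \<open>
  Indexing the coefficients by \<open>I\<close> rather than by the set of points keeps every dilate, including the
  degenerate one for \<open>t = 0\<close>, in the same form: nonnegative combinations of total weight \<open>t\<close>.
\<close>

lemma dilated_convex_hull_finite_image:
  fixes f :: "'i \<Rightarrow> 'a::real_vector"
  assumes "finite I" "I \<noteq> {}" "0 \<le> t"
  shows "(\<lambda>x. t *\<^sub>R x) ` (convex hull (f ` I)) =
    {\<Sum>i\<in>I. c i *\<^sub>R f i | c. (\<forall>i\<in>I. 0 \<le> c i) \<and> sum c I = t}" (is "?L = ?R")
proof -
  have hull: "convex hull (f ` I) =
      {\<Sum>i\<in>I. c i *\<^sub>R f i | c. (\<forall>i\<in>I. 0 \<le> c i) \<and> sum c I = 1}" (is "_ = ?S")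
  proof
    have "convex ?S"
    proof (rule convexI)
      fix x y :: 'a and u v :: real
      assume "x \<in> ?S" "y \<in> ?S" and uv: "0 \<le> u" "0 \<le> v" "u + v = 1"
      then obtain a b where
        a: "x = (\<Sum>i\<in>I. a i *\<^sub>R f i)" "\<forall>i\<in>I. 0 \<le> a i" "sum a I = 1" and
        b: "y = (\<Sum>i\<in>I. b i *\<^sub>R f i)" "\<forall>i\<in>I. 0 \<le> b i" "sum b I = 1" by blast
      have "u *\<^sub>R x + v *\<^sub>R y = (\<Sum>i\<in>I. (u * a i + v * b i) *\<^sub>R f i)"
        unfolding a b by (simp add: scaleR_sum_right sum.distrib scaleR_add_left)
      moreover have "(\<Sum>i\<in>I. u * a i + v * b i) = 1"
        using a b uv by (simp add: sum.distrib flip: sum_distrib_left)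
      moreover have "\<forall>i\<in>I. 0 \<le> u * a i + v * b i" using a b uv by simp
      ultimately show "u *\<^sub>R x + v *\<^sub>R y \<in> ?S"
        by (intro CollectI exI[of _ "\<lambda>i. u * a i + v * b i"] conjI)
    qed
    moreover have "f ` I \<subseteq> ?S"
    proof clarify
      fix j assume j: "j \<in> I"
      show "\<exists>c. f j = (\<Sum>i\<in>I. c i *\<^sub>R f i) \<and> (\<forall>i\<in>I. 0 \<le> c i) \<and> sum c I = 1"
        using j assms(1)
        by (intro exI[of _ "\<lambda>i. if i = j then 1 else 0"])
           (simp add: if_distrib[of "\<lambda>c. c *\<^sub>R _"] cong: if_cong)
    qed
    ultimately show "convex hull (f ` I) \<subseteq> ?S" by (rule hull_minimal[rotated])
    show "?S \<subseteq> convex hull (f ` I)"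
      by (auto intro!: convex_sum[OF assms(1) convex_convex_hull] intro: hull_inc)
  qed
  show ?thesis
  proof
    show "?L \<subseteq> ?R"
    proof clarify
      fix x assume "x \<in> convex hull (f ` I)"
      then obtain c where c: "x = (\<Sum>i\<in>I. c i *\<^sub>R f i)" "\<forall>i\<in>I. 0 \<le> c i" "sum c I = 1"
        unfolding hull by blast
      show "\<exists>c. t *\<^sub>R x = (\<Sum>i\<in>I. c i *\<^sub>R f i) \<and> (\<forall>i\<in>I. 0 \<le> c i) \<and> sum c I = t"
        using c assms(3)
        by (intro exI[of _ "\<lambda>i. t * c i"])
           (simp add: scaleR_sum_right flip: sum_distrib_left)
    qed
    show "?R \<subseteq> ?L"
    proof clarify
      fix c assume c: "\<forall>i\<in>I. 0 \<le> c i" "t = sum c I"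
      show "(\<Sum>i\<in>I. c i *\<^sub>R f i) \<in> (\<lambda>x. sum c I *\<^sub>R x) ` (convex hull (f ` I))"
      proof (cases "sum c I = 0")
        case True
        then have "\<forall>i\<in>I. c i = 0" using c assms(1) by (simp add: sum_nonneg_eq_0_iff)
        moreover obtain j where "j \<in> I" using assms(2) by blast
        then have "f j \<in> convex hull (f ` I)" by (simp add: hull_inc)
        ultimately show ?thesis using True by (auto intro!: image_eqI[of _ _ "f j"])
      next
        case False
        have "0 \<le> sum c I" using c by (simp add: sum_nonneg)
        then have "(\<Sum>i\<in>I. (c i / sum c I) *\<^sub>R f i) \<in> convex hull (f ` I)"
          unfolding hull using c False
          by (auto intro!: exI[of _ "\<lambda>i. c i / sum c I"] simp flip: sum_divide_distrib)
        moreover have "(\<Sum>i\<in>I. c i *\<^sub>R f i) = sum c I *\<^sub>R (\<Sum>i\<in>I. (c i / sum c I) *\<^sub>R f i)"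
          using False by (simp add: scaleR_sum_right)
        ultimately show ?thesis by blast
      qed
    qed
  qed
qed

lemma lookup_scaleR [simp]:
  fixes x :: "'a \<Rightarrow>\<^sub>0 'b::real_vector"
  shows "Poly_Mapping.lookup (r *\<^sub>R x) i = r *\<^sub>R Poly_Mapping.lookup x i"
proof -
  have "{i. r *\<^sub>R Poly_Mapping.lookup x i \<noteq> 0} \<subseteq> {i. Poly_Mapping.lookup x i \<noteq> 0}" by auto
  then have "finite {i. r *\<^sub>R Poly_Mapping.lookup x i \<noteq> 0}"
    using finite_lookup finite_subset by blast
  then show ?thesis by (simp add: scaleR_poly_mapping_def)
qed

text \<open>
  The origin gets the last index \<open>d\<close>, so that every other vertex except the top \<open>(1, 1, k)\<close> of the
  tetrahedron is the unit vector of its own index, and the top takes the remaining index 2. Passing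
  from \<open>d\<close> to \<open>d + 1\<close> then only inserts the new apex at index \<open>d\<close> and moves the origin.
\<close>

definition pyr_vertex :: "nat \<Rightarrow> nat \<Rightarrow> nat \<Rightarrow> point" where
  "pyr_vertex d k i =
    (if i = d then 0
     else if i = 2 then Poly_Mapping.single 0 1 + Poly_Mapping.single 1 1
       + Poly_Mapping.single 2 (real k)
     else Poly_Mapping.single i 1)"

definition reeve_pyramid :: "nat \<Rightarrow> nat \<Rightarrow> point set" where
  "reeve_pyramid d k = convex hull (pyr_vertex d k ` {..d})"

lemma pyr_iter_reeve:
  "pyr_iter m 3 (reeve_tetrahedron (int k)) = reeve_pyramid (m + 3) k"
proof (induction m)
  case 0
  have "{..3::nat} = {3,0,1,2}" by auto
  then show ?case
    by (simp add: reeve_tetrahedron_def reeve_pyramid_def pyr_vertex_def insert_commute)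
next
  case (Suc m)
  have "insert (Poly_Mapping.single (m + 3) 1) (pyr_vertex (m + 3) k ` {..m + 3})
      = pyr_vertex (Suc m + 3) k ` {..Suc m + 3}" (is "?L = ?R")
  proof -
    have "{..m + 3} = insert (m + 3) {..<m + 3}" "{..Suc m + 3} = insert (Suc m + 3) (insert (m + 3) {..<m + 3})"
      by auto
    moreover have "pyr_vertex (m + 3) k ` {..<m + 3} = pyr_vertex (Suc m + 3) k ` {..<m + 3}"
      by (rule image_cong) (auto simp: pyr_vertex_def)
    moreover have "pyr_vertex (m + 3) k (m + 3) = 0" "pyr_vertex (Suc m + 3) k (Suc m + 3) = 0"
      "pyr_vertex (Suc m + 3) k (m + 3) = Poly_Mapping.single (m + 3) 1"
      by (simp_all add: pyr_vertex_def)
    ultimately show ?thesis by (auto simp only: image_insert)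
  qed
  then have "pyr (m + 3) (reeve_pyramid (m + 3) k) = reeve_pyramid (Suc m + 3) k"
    by (simp add: pyr_def reeve_pyramid_def flip: hull_insert)
  then show ?case using Suc by (simp add: add.commute)
qed

definition vertex_comb :: "nat \<Rightarrow> nat \<Rightarrow> (nat \<Rightarrow> real) \<Rightarrow> point" where
  "vertex_comb d k c = (\<Sum>i\<le>d. c i *\<^sub>R pyr_vertex d k i)"

text \<open>
  The coefficient of the top vertex can be read off coordinate 2, and then every other coefficient
  except that of the origin off its own coordinate. Injectivity of barycentric coordinates, affine
  independence and the lattice point analysis all rest on this triangular system.
\<close>

lemma lookup_vertex_comb:
  assumes "3 \<le> d"
  shows "Poly_Mapping.lookup (vertex_comb d k c) j =
    (if j < 2 then c j + c 2 else if j = 2 then real k * c 2 else if j < d then c j else 0)"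
proof -
  let ?w = "\<lambda>j. if j < 2 then 1 else if j = 2 then real k else (0::real)"
  have "Poly_Mapping.lookup (vertex_comb d k c) j = (\<Sum>i\<le>d. c i * Poly_Mapping.lookup (pyr_vertex d k i) j)"
    by (simp add: vertex_comb_def lookup_sum)
  \<comment> \<open>Separate the unit vector at coordinate \<open>j\<close> from the contribution of the top vertex.\<close>
  also have "\<dots> = (\<Sum>i\<le>d. (if i = j then if j \<noteq> 2 \<and> j < d then c j else 0 else 0)
      + (if i = 2 then c 2 * ?w j else 0))"
    using assms
    by (intro sum.cong refl)
       (auto simp: pyr_vertex_def lookup_add lookup_single lookup_one less_2_cases_iff when_def)
  also have "\<dots> = (if j < 2 then c j + c 2 else if j = 2 then real k * c 2
      else if j < d then c j else 0)"
    using assms by (auto simp: sum.distrib sum.delta')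
  finally show ?thesis .
qed

lemma vertex_comb_inject:
  assumes "3 \<le> d" "0 < k" and eq: "vertex_comb d k a = vertex_comb d k b"
    and sum: "sum a {..d} = sum b {..d}" and "i \<le> d"
  shows "a i = b i"
proof -
  have l: "Poly_Mapping.lookup (vertex_comb d k a) j = Poly_Mapping.lookup (vertex_comb d k b) j" for j
    using eq by simp
  have 2: "a 2 = b 2" using l[of 2] assms(1,2) by (simp add: lookup_vertex_comb)
  have lt: "a j = b j" if "j < d" for j
    using l[of j] assms(1,2) 2 that by (auto simp: lookup_vertex_comb split: if_splits)
  have "sum a {..<d} = sum b {..<d}" using lt by simp
  then have "a d = b d" using sum by (simp flip: lessThan_Suc_atMost)
  then show ?thesis using lt \<open>i \<le> d\<close> by (cases "i = d") auto
qed

lemma inj_on_pyr_vertex: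
  assumes "3 \<le> d" "0 < k"
  shows "inj_on (pyr_vertex d k) {..d}"
proof (rule inj_onI)
  fix i j assume ij: "i \<in> {..d}" "j \<in> {..d}" "pyr_vertex d k i = pyr_vertex d k j"
  let ?e = "\<lambda>i m. if m = i then 1 else (0::real)"
  have e: "vertex_comb d k (?e m) = pyr_vertex d k m" "sum (?e m) {..d} = 1" if "m \<le> d" for m
    using that by (simp_all add: vertex_comb_def if_distrib[of "\<lambda>c. c *\<^sub>R _"] cong: if_cong)
  have "?e i i = ?e j i"
    using ij by (intro vertex_comb_inject[OF assms, of "?e i" "?e j" i]) (simp_all add: e)
  then show "i = j" by (simp split: if_splits)
qed

lemma pyr_vertices_affine_independent:
  assumes "3 \<le> d" "0 < k"
  shows "\<not> affine_dependent (pyr_vertex d k ` {..d})"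
proof
  assume "affine_dependent (pyr_vertex d k ` {..d})"
  then obtain U where "sum U (pyr_vertex d k ` {..d}) = 0" "\<exists>v\<in>pyr_vertex d k ` {..d}. U v \<noteq> 0"
      "(\<Sum>v\<in>pyr_vertex d k ` {..d}. U v *\<^sub>R v) = 0"
    by (auto simp: affine_dependent_explicit_finite)
  then have U: "sum (U \<circ> pyr_vertex d k) {..d} = 0" "vertex_comb d k (U \<circ> pyr_vertex d k) = 0"
      and ex: "\<exists>i\<le>d. U (pyr_vertex d k i) \<noteq> 0"
    by (auto simp: vertex_comb_def sum.reindex[OF inj_on_pyr_vertex[OF assms]])
  have "(U \<circ> pyr_vertex d k) i = 0" if "i \<le> d" for i
    using that U by (intro vertex_comb_inject[OF assms, of _ "\<lambda>_. 0"]) (auto simp: vertex_comb_def)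
  then show False using ex by auto
qed

lemma card_pyr_vertices:
  assumes "3 \<le> d" "0 < k"
  shows "card (pyr_vertex d k ` {..d}) = d + 1"
  using inj_on_pyr_vertex[OF assms] by (simp add: card_image)

text \<open>
  Since the origin is a vertex, the affine hull is the linear span of the other \<open>d\<close> vertices, and it
  coincides with its own direction space.
\<close>

lemma polytope_dim_reeve_pyramid:
  assumes "3 \<le> d" "0 < k"
  shows "polytope_dim (reeve_pyramid d k) = d"
proof -
  let ?V = "pyr_vertex d k ` {..d}" and ?B = "pyr_vertex d k ` {..<d}"
  have V: "?V = insert 0 ?B"
  proof -
    have "{..d} = insert d {..<d}" by auto
    then show ?thesis by (simp add: pyr_vertex_def[of d k d])
  qed
  have nz: "0 \<notin> ?B"
  proof clarify
    fix i assume i: "0 = pyr_vertex d k i" "i < d"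
    then have "pyr_vertex d k i = pyr_vertex d k d" by (simp add: pyr_vertex_def[of d k d])
    then have "i = d" using i(2) by (intro inj_onD[OF inj_on_pyr_vertex[OF assms]]) auto
    then show False using i(2) by simp
  qed
  have ind: "independent ?B"
    using pyr_vertices_affine_independent[OF assms] affine_dependent_iff_dependent[OF nz]
    unfolding V by simp
  have "affine hull (reeve_pyramid d k) = span ?V"
    unfolding reeve_pyramid_def
    by (simp add: affine_hull_span_0 V hull_inc)
  also have "\<dots> = span ?B" unfolding V by simp
  finally have aff: "affine hull (reeve_pyramid d k) = span ?B" .
  have diff: "{x - y |x y. x \<in> span ?B \<and> y \<in> span ?B} = span ?B"
    by (auto intro: span_diff) (metis diff_zero span_zero)
  have "polytope_dim (reeve_pyramid d k) = card ?B"
    unfolding polytope_dim_def aff diff using ind by (rule dim_span_eq_card_independent)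
  also have "\<dots> = d"
    by (subst card_image) (auto intro: inj_on_subset[OF inj_on_pyr_vertex[OF assms]])
  finally show ?thesis .
qed

section \<open>Lattice points in dilates\<close>

text \<open>
  For \<open>0 < r < k\<close> these are the coefficients in \<open>[0, 1)\<close> that express the point \<open>e\<^sub>0 + e\<^sub>1 + r e\<^sub>2\<close> in
  the vertices at height one: the top vertex must contribute \<open>r / k\<close>, the unit vectors \<open>e\<^sub>0\<close> and \<open>e\<^sub>1\<close>
  complete this to an integer, and the origin brings the total weight up to the integer
  \<open>box_height r\<close>.
\<close>

definition box_coeff :: "nat \<Rightarrow> nat \<Rightarrow> nat \<Rightarrow> nat \<Rightarrow> real" where
  "box_coeff d k r i =
    (if r = 0 then 0 else if i < 2 then 1 - real r / real k
     else if i = 2 \<or> i = d then real r / real k else 0)"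

definition box_height :: "nat \<Rightarrow> nat" where
  "box_height r = (if r = 0 then 0 else 2)"

lemma sum_box_coeff:
  assumes "3 \<le> d"
  shows "(\<Sum>i\<le>d. box_coeff d k r i) = real (box_height r)"
proof -
  have "{..d} = {0,1,2,d} \<union> {3..<d}" using assms by auto
  moreover have "(\<Sum>i\<in>{0,1,2,d} \<union> {3..<d}. box_coeff d k r i) = (\<Sum>i\<in>{0,1,2,d}. box_coeff d k r i)"
    by (rule sum.mono_neutral_right) (auto simp: box_coeff_def)
  ultimately show ?thesis using assms by (simp add: box_coeff_def box_height_def)
qed

text \<open>
  Split the barycentric coordinates of a point of the dilate into integer and fractional parts.
  If the point is a lattice point with coordinate \<open>m\<close> in direction 2, the coefficient of the top vertex
  is \<open>m / k\<close>, so its fractional part is \<open>r / k\<close> for \<open>r = m mod k\<close>. Integrality of the other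
  coordinates, and of the total weight, then forces the fractional parts of all coefficients to be
  those of the box point \<open>r\<close>. The integer parts form the list \<open>l\<close>, one entry for each vertex.
\<close>

lemma dilated_reeve_pyramid_lattice:
  assumes d: "3 \<le> d" and k: "0 < k"
  shows "bij_betw (\<lambda>(r, l). vertex_comb d k (\<lambda>i. real (l ! i) + box_coeff d k r i))
    (SIGMA r:{..<k}. {l. length l = d + 1 \<and> sum_list l + box_height r = t})
    ((\<lambda>x. real t *\<^sub>R x) ` reeve_pyramid d k \<inter> int_lattice d)"
    (is "bij_betw ?f ?A ?B")
proof -
  have B: "?B = {vertex_comb d k c | c. (\<forall>i\<le>d. 0 \<le> c i) \<and> sum c {..d} = real t} \<inter> int_lattice d"
    unfolding reeve_pyramid_def vertex_comb_def by (subst dilated_convex_hull_finite_image) auto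
  have box01: "0 \<le> box_coeff d k r i" "box_coeff d k r i < 1" if "r < k" for r i
    using that by (auto simp: box_coeff_def)
  have nthsum: "(\<Sum>i\<le>d. real (l ! i)) = real (sum_list l)" if "length l = d + 1" for l :: "nat list"
    using that by (simp add: sum_list_sum_nth atLeast0LessThan lessThan_Suc_atMost)
  have csum: "(\<Sum>i\<le>d. real (l ! i) + box_coeff d k r i) = real t"
    if "length l = d + 1" "sum_list l + box_height r = t" for l r
    using that nthsum[OF that(1)] sum_box_coeff[OF d, of k r] by (auto simp: sum.distrib)
  have "inj_on ?f ?A"
  proof (rule inj_onI)
    fix p q
    assume pq: "p \<in> ?A" "q \<in> ?A" "?f p = ?f q"
    obtain r l where p: "p = (r, l)" by (cases p)
    obtain s m where q: "q = (s, m)" by (cases q)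
    have rl: "r < k" "length l = d + 1" "sum_list l + box_height r = t"
      and sm: "s < k" "length m = d + 1" "sum_list m + box_height s = t"
      and eq: "vertex_comb d k (\<lambda>i. real (l ! i) + box_coeff d k r i) = vertex_comb d k (\<lambda>i. real (m ! i) + box_coeff d k s i)"
      using pq by (auto simp: p q)
    have same: "real (l ! i) + box_coeff d k r i = real (m ! i) + box_coeff d k s i" if "i \<le> d" for i
      using csum[OF rl(2,3)] csum[OF sm(2,3)] that
      by (intro vertex_comb_inject[OF d k eq]) auto
    \<comment> \<open>Comparing fractional parts separates the box point from the integer combination.\<close>
    have "frac (real (l ! i) + box_coeff d k r i) = box_coeff d k r i" if "r < k" for l :: "nat list" and r i
      using box01[OF that] by (simp add: frac_unique_iff)
    then have bb: "box_coeff d k r i = box_coeff d k s i" if "i \<le> d" for i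
      using same[OF that] rl(1) sm(1) by metis
    have "r = s" using bb[of 2] d k by (simp add: box_coeff_def split: if_splits)
    moreover have "l = m"
      using same bb rl(2) sm(2) by (intro nth_equalityI) (auto simp: less_Suc_eq_le)
    ultimately show "p = q" by (simp add: p q)
  qed
  moreover have "?f ` ?A \<subseteq> ?B"
  proof clarify
    fix r l assume rl: "r < k" "length l = d + 1" "t = sum_list l + box_height r"
    let ?c = "\<lambda>i. real (l ! i) + box_coeff d k r i"
    have "vertex_comb d k ?c \<in> int_lattice d"
    proof -
      have "Poly_Mapping.lookup (vertex_comb d k ?c) j \<in> \<int>" for j
      proof -
        consider "j < 2" | "j = 2" | "2 < j" "j < d" | "d \<le> j" by linarith
        then have "Poly_Mapping.lookup (vertex_comb d k ?c) j =
          real (if j < 2 then l ! j + l ! 2 + (if r = 0 then 0 else 1)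
            else if j = 2 then k * l ! 2 + r else if j < d then l ! j else 0)"
        proof cases
          case 2
          then show ?thesis using k by (simp add: lookup_vertex_comb[OF d] box_coeff_def distrib_left)
        qed (use d in \<open>simp_all add: lookup_vertex_comb[OF d] box_coeff_def\<close>)
        then show ?thesis by (simp only: Ints_of_nat)
      qed
      moreover have "Poly_Mapping.keys (vertex_comb d k ?c) \<subseteq> {..<d}"
        using d by (auto simp: in_keys_iff lookup_vertex_comb split: if_splits)
      ultimately show ?thesis by (simp add: int_lattice_def)
    qed
    moreover have "\<forall>i\<le>d. 0 \<le> ?c i" using box01[OF rl(1)] by simp
    moreover have "sum ?c {..d} = real t" using csum[of l r] rl by simp
    ultimately have "vertex_comb d k ?c \<in> ?B" unfolding B by blast
    then show "vertex_comb d k ?c \<in> (\<lambda>x. real (sum_list l + box_height r) *\<^sub>R x) ` reeve_pyramid d k \<inter> int_lattice d"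
      by (simp only: rl(3))
  qed
  moreover have "?B \<subseteq> ?f ` ?A"
  proof
    fix x assume "x \<in> ?B"
    then obtain c where x: "x = vertex_comb d k c" and c: "\<And>i. i \<le> d \<Longrightarrow> 0 \<le> c i" "sum c {..d} = real t"
      and lattice: "vertex_comb d k c \<in> int_lattice d"
      unfolding B by blast
    have int: "\<And>j. j < d \<Longrightarrow> Poly_Mapping.lookup (vertex_comb d k c) j \<in> \<int>"
      using lattice by (simp add: int_lattice_def)
    from int[of 2] obtain m :: int where m: "real k * c 2 = of_int m"
      using d by (auto simp: lookup_vertex_comb elim: Ints_cases)
    define r where "r = nat (m mod int k)"
    have r: "int r = m mod int k" "r < k" using k by (auto simp: r_def nat_less_iff)
    have "m = int k * (m div int k) + int r" using r(1) by simp
    then have "real k * c 2 = real k * of_int (m div int k) + real r"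
      unfolding m by (metis of_int_add of_int_mult of_int_of_nat_eq)
    then have "c 2 - real r / real k = of_int (m div int k)" using k by (simp add: field_simps)
    then have c2: "c 2 - real r / real k \<in> \<int>" by simp
    have lt: "c i - box_coeff d k r i \<in> \<int>" if i: "i < d" for i
    proof -
      consider "i < 2" | "i = 2" | "2 < i" by linarith
      then show ?thesis
      proof cases
        case 1
        then have cc: "c i + c 2 \<in> \<int>" using int[OF i] d by (simp add: lookup_vertex_comb)
        have "(if r = 0 then 0 else 1 :: real) \<in> \<int>" by simp
        then have "(c i + c 2) - (c 2 - real r / real k) - (if r = 0 then 0 else 1) \<in> \<int>"
          by (rule Ints_diff[OF Ints_diff[OF cc c2]])
        also have "(c i + c 2) - (c 2 - real r / real k) - (if r = 0 then 0 else 1)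
            = c i - box_coeff d k r i" using 1 by (simp add: box_coeff_def)
        finally show ?thesis .
      next
        case 2
        then show ?thesis using c2 by (auto simp: box_coeff_def)
      next
        case 3
        then show ?thesis using int[OF i] i d by (simp add: lookup_vertex_comb box_coeff_def)
      qed
    qed
    \<comment> \<open>The coefficient of the origin affects no coordinate; the total weight determines it.\<close>
    have "(\<Sum>i\<le>d. c i - box_coeff d k r i) = real t - real (box_height r)"
      using c(2) sum_box_coeff[OF d, of k r] by (simp add: sum_subtractf)
    then have "c d - box_coeff d k r d = real t - real (box_height r) - (\<Sum>i<d. c i - box_coeff d k r i)"
      by (simp flip: lessThan_Suc_atMost)
    moreover have "(\<Sum>i<d. c i - box_coeff d k r i) \<in> \<int>" by (rule Ints_sum) (simp add: lt)
    then have "real t - real (box_height r) - (\<Sum>i<d. c i - box_coeff d k r i) \<in> \<int>"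
      by (intro Ints_diff Ints_of_nat)
    ultimately have "c i - box_coeff d k r i \<in> \<int>" if "i \<le> d" for i
      using lt that by (cases "i = d") auto
    then have fr: "frac (c i) = box_coeff d k r i" if "i \<le> d" for i
      using that box01[OF r(2)] by (simp add: frac_unique_iff)
    define l where "l = map (\<lambda>i. nat \<lfloor>c i\<rfloor>) [0..<d+1]"
    have len: "length l = d + 1" by (simp add: l_def)
    have li: "real (l ! i) + box_coeff d k r i = c i" if "i \<le> d" for i
    proof -
      have "l ! i = nat \<lfloor>c i\<rfloor>" using that by (simp add: l_def del: upt_Suc)
      then show ?thesis using c(1)[OF that] fr[OF that] by (simp add: frac_def)
    qed
    have "(\<Sum>i\<le>d. real (l ! i) + box_coeff d k r i) = sum c {..d}"
      by (rule sum.cong) (simp_all add: li)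
    then have "real (sum_list l) + real (box_height r) = real t"
      unfolding sum.distrib nthsum[OF len] sum_box_coeff[OF d] c(2) .
    then have "sum_list l + box_height r = t" by linarith
    then have "(r, l) \<in> ?A" using r len by simp
    moreover have "x = ?f (r, l)" using li by (simp add: x vertex_comb_def)
    ultimately show "x \<in> ?f ` ?A" by blast
  qed
  ultimately show ?thesis unfolding bij_betw_def by blast
qed

text \<open>
  The weight \<open>t\<close> is split into \<open>d + 1\<close> nonnegative integers for the box point at the origin, and
  \<open>t - 2\<close> is split in the same way for each of the other \<open>k - 1\<close> box points. The case distinction on
  \<open>t\<close> is real: for \<open>t < 2\<close> there are no such splittings, whereas truncated subtraction would count one.
\<close>

lemma lattice_count_reeve_pyramid:
  assumes d: "3 \<le> d" and k: "0 < k"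
  shows "lattice_count d (reeve_pyramid d k) t =
    (t + d choose d) + (if 2 \<le> t then (k - 1) * (t - 2 + d choose d) else 0)"
proof -
  let ?L = "\<lambda>r. {l::nat list. length l = d + 1 \<and> sum_list l + box_height r = t}"
  have fin: "finite {l::nat list. length l = d + 1 \<and> sum_list l = N}" for N
  proof (rule finite_subset)
    show "{l::nat list. length l = d + 1 \<and> sum_list l = N} \<subseteq> {l. set l \<subseteq> {..N} \<and> length l = d + 1}"
      using member_le_sum_list by fastforce
  qed (simp add: finite_lists_length_eq)
  have L: "?L r = (if box_height r \<le> t then {l::nat list. length l = d + 1 \<and> sum_list l = t - box_height r} else {})" for r
    by auto
  have cardL: "card (?L r) = (if box_height r \<le> t then (t - box_height r + d choose d) else 0)" for r
    unfolding L using card_length_sum_list[of "d + 1" "t - box_height r"]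
      binomial_symmetric[of "t - box_height r" "t - box_height r + d"]
    by simp
  have finL: "finite (?L r)" for r
    unfolding L using fin by simp
  have "lattice_count d (reeve_pyramid d k) t = card (SIGMA r:{..<k}. ?L r)"
    unfolding lattice_count_def
    using bij_betw_same_card[OF dilated_reeve_pyramid_lattice[OF d k, of t]] by simp
  also have "\<dots> = (\<Sum>r<k. card (?L r))"
    using finL by (intro card_SigmaI) blast+
  also have "{..<k} = insert 0 {1..<k}" using k by auto
  also have "(\<Sum>r\<in>insert 0 {1..<k}. card (?L r)) = card (?L 0) + (\<Sum>r\<in>{1..<k}. card (?L r))"
    by simp
  also have "(\<Sum>r\<in>{1..<k}. card (?L r)) = (\<Sum>r\<in>{1..<k}. if 2 \<le> t then (t - 2 + d choose d) else 0)"
    unfolding cardL by (rule sum.cong) (auto simp: box_height_def)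
  also have "\<dots> = (if 2 \<le> t then (k - 1) * (t - 2 + d choose d) else 0)" by simp
  also have "card (?L 0) = (t + d choose d)" unfolding cardL by (simp add: box_height_def)
  finally show ?thesis .
qed

text \<open>
  Emptiness is a counting argument: there are \<open>d + 1\<close> lattice points in the first dilate, and the
  \<open>d + 1\<close> vertices are among them.
\<close>

lemma empty_lattice_simplex_reeve_pyramid:
  assumes d: "3 \<le> d" and k: "0 < k"
  shows "empty_lattice_simplex d d (reeve_pyramid d k)"
proof -
  let ?V = "pyr_vertex d k ` {..d}" and ?S = "reeve_pyramid d k \<inter> int_lattice d"
  have V: "?V \<subseteq> int_lattice d"
    using d by (auto simp: int_lattice_def pyr_vertex_def lookup_add lookup_single lookup_one in_keys_iff when_def
        split: if_splits)
  have "?V \<subseteq> ?S" using V by (auto simp: reeve_pyramid_def hull_inc)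
  moreover have "card ?S = d + 1"
    using lattice_count_reeve_pyramid[OF d k, of 1] by (simp add: lattice_count_def)
  moreover from this have "finite ?S" by (metis card.infinite add_is_0 one_neq_zero)
  ultimately have "?V = ?S" using card_pyr_vertices[OF d k] by (intro card_subset_eq) auto
  then show ?thesis
    unfolding empty_lattice_simplex_def
    using V pyr_vertices_affine_independent[OF d k] card_pyr_vertices[OF d k]
    by (intro exI[of _ ?V]) (auto simp: reeve_pyramid_def)
qed

section \<open>The Ehrhart polynomial and the \<open>h\<^sup>*\<close>-polynomial\<close>

text \<open>
  The numbers \<open>t + d choose d\<close> are the coefficients of \<open>(1 - z)\<^sup>-\<^sup>d\<^sup>-\<^sup>1\<close>, and shifting \<open>t\<close> by two
  multiplies by \<open>z\<^sup>2\<close>. Uniqueness holds because the power of \<open>1 - z\<close> is a unit.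
\<close>

lemma h_star_reeve_pyramid:
  assumes d: "3 \<le> d" and k: "0 < k"
  shows "h_star_poly d (reeve_pyramid d k) = [:1, 0, real k - 1:]"
proof -
  let ?P = "reeve_pyramid d k" and ?q = "[:1, 0, real k - 1:] :: real poly"
  let ?E = "Abs_fps (\<lambda>t. real (lattice_count d ?P t))"
  let ?u = "(1 - fps_X) ^ (d + 1) :: real fps"
  have u0: "?u \<noteq> 0" "fps_nth ?u 0 \<noteq> 0" by (auto simp: fps_power_zeroth simp del: power_Suc)
  have inv: "inverse ?u = Abs_fps (\<lambda>t. real (t + d choose d))"
    using one_minus_const_fps_X_neg_power'[of "d + 1" "1::real"]
    by (simp add: add.commute binomial_symmetric[of d])
  have q: "fps_of_poly ?q = 1 + fps_const (real k - 1) * fps_X ^ 2"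
    by (rule fps_ext) (auto simp: coeff_pCons fps_X_power_nth split: nat.splits)
  have "?E = fps_of_poly ?q * inverse ?u"
    unfolding q inv
    using k by (intro fps_ext)
      (auto simp: lattice_count_reeve_pyramid[OF d k] ring_distribs mult.assoc fps_X_power_mult_nth of_nat_diff)
  then have E: "?E = fps_of_poly ?q / ?u" using u0 by (simp add: fps_divide_unit)
  show ?thesis
    unfolding h_star_poly_def polytope_dim_reeve_pyramid[OF d k]
  proof (rule the_equality)
    show "degree ?q \<le> d \<and> ?E = fps_of_poly ?q / ?u" using E d by (simp add: degree_pCons_eq_if)
  next
    fix p :: "real poly" assume p: "degree p \<le> d \<and> ?E = fps_of_poly p / ?u"
    then have "fps_of_poly p * inverse ?u = fps_of_poly ?q * inverse ?u"
      using E u0 by (simp add: fps_divide_unit)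
    moreover have "inverse ?u \<noteq> 0" using u0 by (simp add: fps_inverse_eq_0_iff)
    ultimately have "fps_of_poly p = fps_of_poly ?q" by (metis mult_cancel_right)
    then show "p = ?q" by (simp only: fps_of_poly_eq_iff)
  qed
qed

text \<open>
  Multiplied by the indeterminate, the product becomes the rising factorial of length \<open>d + 1\<close>, whose
  coefficients are the Stirling numbers.
\<close>

lemma coeff_1_prod_rising:
  "coeff (\<Prod>i=1..d. [:real i, 1:]) 1 = real (stirling (d + 1) 2)"
proof -
  let ?p = "\<Prod>i=1..d. [:real i, 1:]" and ?s = "\<Sum>k\<le>d+1. monom (real (stirling (d+1) k)) k"
  have "poly (pCons 0 ?p) x = poly ?s x" for x
  proof -
    have "poly ?s x = pochhammer x (d + 1)"
      using stirling_pochhammer[of "d + 1" x] by (simp add: poly_sum poly_monom)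
    also have "\<dots> = x * pochhammer (x + 1) d" by (simp add: pochhammer_rec)
    also have "pochhammer (x + 1) d = (\<Prod>i=1..d. x + real i)"
      unfolding pochhammer_prod
      by (rule prod.reindex_bij_witness[of _ "\<lambda>i. i - 1" "Suc"]) auto
    finally show ?thesis by (simp add: poly_prod add.commute)
  qed
  then have eq: "pCons 0 ?p = ?s" by (simp add: poly_eq_poly_eq_iff[symmetric] fun_eq_iff)
  have "coeff ?p 1 = coeff (pCons 0 ?p) 2" by (simp add: numeral_2_eq_2)
  also have "\<dots> = (\<Sum>k\<le>d+1. if k = 2 then real (stirling (d+1) k) else 0)"
    unfolding eq coeff_sum coeff_monom by (rule refl)
  also have "\<dots> = real (stirling (d + 1) 2)" by (auto simp: not_le numeral_2_eq_2)
  finally show ?thesis .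
qed

text \<open>
  The factor for \<open>i = 1\<close> is the indeterminate, so the linear coefficient is the value at zero of
  the remaining factors: \<open>- 1\<close> from \<open>i = 0\<close> and \<open>1, \<dots>, d - 2\<close> from the rest.
\<close>

lemma coeff_1_prod_shifted:
  assumes "2 \<le> d"
  shows "coeff (\<Prod>i<d. [:real i - 1, 1:]) 1 = - fact (d - 2)"
proof -
  obtain n where d: "d = Suc (Suc n)" using assms by (metis add_2_eq_Suc le_Suc_ex)
  let ?q = "\<Prod>i<n. [:real i + 1, 1:]"
  have "(\<Prod>i<d. [:real i - 1, 1:]) = [:-1, 1:] * ([:0, 1:] * ?q)"
    unfolding d by (simp only: prod.lessThan_Suc_shift) (simp add: add.commute)
  also have "coeff \<dots> 1 = - poly ?q 0" by (simp add: poly_0_coeff_0 coeff_mult)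
  also have "poly ?q 0 = fact n"
    by (simp add: poly_prod fact_prod_Suc atLeast0LessThan add.commute)
  finally show ?thesis by (simp add: d)
qed

lemma binomial_as_poly:
  "real (t + d choose d) = poly (\<Prod>i=1..d. [:real i, 1:]) (real t) / fact d"
proof -
  have "real (t + d choose d) = pochhammer (real t + 1) d / fact d"
    by (simp add: binomial_gbinomial gbinomial_pochhammer')
  also have "pochhammer (real t + 1) d = (\<Prod>i=1..d. real t + real i)"
    unfolding pochhammer_prod
    by (rule prod.reindex_bij_witness[of _ "\<lambda>i. i - 1" "Suc"]) auto
  finally show ?thesis by (simp add: poly_prod add.commute)
qed

text \<open>
  The polynomial also gives the right count for \<open>t = 0\<close> and \<open>t = 1\<close>, because both are roots of it
  once \<open>d \<ge> 2\<close>. Only for this reason is the lattice point count a single polynomial in \<open>t\<close>.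
\<close>

lemma shifted_binomial_as_poly:
  assumes "2 \<le> d"
  shows "(if 2 \<le> t then real (t - 2 + d choose d) else 0) =
    poly (\<Prod>i<d. [:real i - 1, 1:]) (real t) / fact d"
proof (cases "2 \<le> t")
  case True
  then have "real (t - 2 + d choose d) = pochhammer (real t - 1) d / fact d"
    by (simp add: binomial_gbinomial gbinomial_pochhammer' of_nat_diff)
  also have "pochhammer (real t - 1) d = (\<Prod>i<d. real t - 1 + real i)"
    by (simp add: pochhammer_prod atLeast0LessThan)
  finally show ?thesis using True by (simp add: poly_prod algebra_simps)
next
  case False
  then have "1 - t < d" "real (1 - t) - 1 + real t = 0" using assms by auto
  then have "(\<Prod>i<d. real i - 1 + real t) = 0" by (intro prod_zero) auto
  then show ?thesis using False by (simp add: poly_prod)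
qed

lemma coeff_1_ehrhart_reeve_pyramid:
  assumes d: "3 \<le> d" and k: "0 < k"
  shows "coeff (ehrhart_poly d (reeve_pyramid d k)) 1 =
    (real (stirling (d + 1) 2) - (real k - 1) * fact (d - 2)) / fact d"
proof -
  let ?a = "\<Prod>i=1..d. [:real i, 1:]" and ?b = "\<Prod>i<d. [:real i - 1, 1:]"
  let ?p = "smult (1 / fact d) (?a + smult (real k - 1) ?b)"
  have p: "poly ?p (real t) = real (lattice_count d (reeve_pyramid d k) t)" for t
  proof -
    have "real (lattice_count d (reeve_pyramid d k) t) = real (t + d choose d)
        + (real k - 1) * (if 2 \<le> t then real (t - 2 + d choose d) else 0)"
      using k by (simp add: lattice_count_reeve_pyramid[OF d k] of_nat_diff)
    also have "\<dots> = poly ?a (real t) / fact d + (real k - 1) * (poly ?b (real t) / fact d)"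
      using binomial_as_poly[of t d] shifted_binomial_as_poly[of d t] d by simp
    finally show ?thesis by (simp add: add_divide_distrib)
  qed
  have "ehrhart_poly d (reeve_pyramid d k) = ?p"
    unfolding ehrhart_poly_def
  proof (rule the_equality)
    show "\<forall>t. poly ?p (real t) = real (lattice_count d (reeve_pyramid d k) t)" using p by blast
  next
    fix q assume q: "\<forall>t. poly q (real t) = real (lattice_count d (reeve_pyramid d k) t)"
    \<comment> \<open>Two polynomials that agree at all natural numbers are equal.\<close>
    show "q = ?p"
    proof (rule ccontr)
      assume "q \<noteq> ?p"
      then have "finite {x. poly (q - ?p) x = 0}" by (intro poly_roots_finite) simp
      moreover have "range real \<subseteq> {x. poly (q - ?p) x = 0}"
        using p q by (auto simp only: poly_diff)
      ultimately have "finite (range real)" by (rule finite_subset[rotated])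
      then show False by (simp add: finite_image_iff inj_on_def)
    qed
  qed
  then show ?thesis
    using coeff_1_prod_rising[of d] coeff_1_prod_shifted[of d] d by simp
qed

lemma stirling_pos:
  assumes "0 < k" "k \<le> n"
  shows "0 < stirling n k"
  using assms
proof (induction n arbitrary: k)
  case (Suc n)
  then obtain j where k: "k = Suc j" by (cases k) auto
  show ?case
  proof (cases "j = 0")
    case True
    then show ?thesis using stirling_Suc_n_1[of n] by (simp only: k One_nat_def fact_gt_zero)
  next
    case False
    then show ?thesis using Suc k by simp
  qed
qed simp

theorem theorem5p1:
  fixes d :: nat and H h :: int
  assumes "3 \<le> d"
    and "H = \<lceil>1 / fact (d - 2) * real (stirling (d + 1) 2)\<rceil> + 1"
    and "H \<le> h"
  shows "empty_lattice_simplex d d (pyr_iter (d - 3) 3 (reeve_tetrahedron h))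
    \<and> \<not> ehrhart_positive d (pyr_iter (d - 3) 3 (reeve_tetrahedron h))
    \<and> \<not> ehrhart_unimodal d (pyr_iter (d - 3) 3 (reeve_tetrahedron h))"
proof -
  let ?s = "real (stirling (d + 1) 2)"
  have "1 / fact (d - 2) * ?s \<le> real_of_int (H - 1)" using assms(2) by simp
  also have "\<dots> \<le> real_of_int (h - 1)" using assms(3) by simp
  finally have bound: "?s \<le> (real_of_int h - 1) * fact (d - 2)" by (simp add: field_simps)
  \<comment> \<open>Positivity of the Stirling number turns the bound into \<open>h > 1\<close>, which non-unimodality needs.\<close>
  have "stirling (d + 1) 2 \<noteq> 0" using stirling_pos[of 2 "d + 1"] assms(1) by simp
  then have "0 < (real_of_int h - 1) * fact (d - 2)" using bound by linarith
  then have "1 < h" by (simp add: zero_less_mult_iff)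
  then obtain k where h: "h = int k" and k: "1 < k"
    by (metis nat_0_le less_imp_le of_nat_1 of_nat_less_iff zero_less_one less_trans)
  have P: "pyr_iter (d - 3) 3 (reeve_tetrahedron h) = reeve_pyramid d k"
    using pyr_iter_reeve[of "d - 3" k] assms(1) by (simp add: h)
  let ?P = "reeve_pyramid d k"
  have k0: "0 < k" using k by simp
  have dim: "polytope_dim ?P = d" using assms(1) k0 by (rule polytope_dim_reeve_pyramid)
  have "coeff (ehrhart_poly d ?P) 1 \<le> 0"
    unfolding coeff_1_ehrhart_reeve_pyramid[OF assms(1) k0]
    using bound by (simp add: h divide_le_0_iff)
  then have "\<not> ehrhart_positive d ?P"
    unfolding ehrhart_positive_def dim using assms(1) by (auto simp: not_less intro!: exI[of _ 1])
  moreover have "\<not> ehrhart_unimodal d ?P"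
  proof
    assume "ehrhart_unimodal d ?P"
    then obtain m where up: "\<And>j. j < m \<Longrightarrow> coeff [:1, 0, real k - 1:] j \<le> coeff [:1, 0, real k - 1:] (j + 1)"
      and down: "\<And>j. m \<le> j \<Longrightarrow> j < d \<Longrightarrow> coeff [:1, 0, real k - 1:] (j + 1) \<le> coeff [:1, 0, real k - 1:] j"
      unfolding ehrhart_unimodal_def dim h_star_reeve_pyramid[OF assms(1) k0] by blast
    show False
    proof (cases "m = 0")
      case True
      then show False using down[of 1] assms(1) k by simp
    next
      case False
      then show False using up[of 0] by simp
    qed
  qed
  ultimately show ?thesis
    unfolding P using empty_lattice_simplex_reeve_pyramid[OF assms(1) k0] by blast
qed

end
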